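(* Let $d,s\in\mathbb N$, let $A=(A_n)_{n\in\mathbb Z}\in \mathcal L^{\rm Lya}(\mathbb Z,\mathbb R^{d\times d})$ and $B=(B_n)_{n\in\mathbb Z}\in \mathcal L^{\infty}(\mathbb Z,\mathbb R^{d\times s})$, and suppose the discrete time-varying linear control system \[ x_{n+1}=A_nx_n+B_nu_n,\qquad n\in\mathbb Z, \] is uniformly completely controllable. Then the dichotomy spectrum of the closed-loop system is assignable: for every integer $\ell$ with $1\le \ell\le d$ and every family of pairwise disjoint closed intervals $[a_1,b_1],\dots,[a_\ell,b_\ell]\subset\mathbb R$ (with $a_i\le b_i$), there exists a bounded feedback $U=(U_n)_{n\in\mathbb Z}\in\mathcal L^{\infty}(\mathbb Z,\mathbb R^{s\times d})$ such that $A+BU:=(A_n+B_nU_n)_{n\in\mathbb Z}\in \mathcal L^{\rm Lya}(\mathbb Z,\mathbb R^{d\times d})$ and the dichotomy spectrum of the closed-loop system $x_{n+1}=(A_n+B_nU_n)x_n$ satisfies \[ \Sigma_{\rm ED}(A+BU)=\bigcup_{i=1}^{\ell}[a_i,b_i]. \]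
   Context: For a set $\mathbb T\in\{\mathbb Z,\mathbb Z_{\ge0},\mathbb Z_{\le0}\}$, $\mathcal L^{\infty}(\mathbb T,\mathbb R^{d\times s})$ denotes the set of sequences $M=(M_n)_{n\in\mathbb T}$ of $d\times s$ real matrices with $\sup_{n}\|M_n\|<\infty$, and $\mathcal L^{\rm Lya}(\mathbb T,\mathbb R^{d\times d})$ (Lyapunov sequences) denotes the set of $M\in\mathcal L^\infty(\mathbb T,\mathbb R^{d\times d})$ such that each $M_n$ is invertible and $(M_n^{-1})_{n}\in \mathcal L^\infty(\mathbb T,\mathbb R^{d\times d})$. For $M\in\mathcal L^{\rm Lya}(\mathbb Z,\mathbb R^{d\times d})$ the evolution operator of $x_{n+1}=M_nx_n$ is $\Phi_M(m,n)=M_{m-1}\cdots M_n$ for $m>n$, $\Phi_M(n,n)=\mathrm{id}$, and $\Phi_M(m,n)=M_m^{-1}\cdots M_{n-1}^{-1}$ for $m<n$. The system admits an exponential dichotomy (ED) on $\mathbb T$ if there are $K,\alpha>0$ and projections $(P_n)_{n\in\mathbb T}$ (invariant, i.e. $P_m\Phi_M(m,n)=\Phi_M(m,n)P_n$) with $\|\Phi_M(m,n)P_n\|\le Ke^{-\alpha(m-n)}$ for $m\ge n$ and $\|\Phi_M(m,n)(\mathrm{id}-P_n)\|\le Ke^{\alpha(m-n)}$ for $m\le n$, $m,n\in\mathbb T$. The dichotomy spectrum is $\Sigma_{\rm ED}(M)=\{\gamma\in\mathbb R: x_{n+1}=e^{-\gamma}M_nx_n \text{ has no ED on }\mathbb Z\}$.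 Uniform complete controllability: there exist $\alpha>0$ and $K\in\mathbb N$ such that for all $\xi\in\mathbb R^d$ and $k_0\in\mathbb Z$ there is a control sequence $u_{k_0},\dots,u_{k_0+K-1}$ such that the solution of $x_{n+1}=A_nx_n+B_nu_n$ with $x_{k_0}=0$ satisfies $x_{k_0+K}=\xi$, and $\|u_n\|\le\alpha\|\xi\|$ for $n=k_0,\dots,k_0+K-1$. *)

theory Defs
  imports "HOL-Analysis.Analysis"
begin

definition mnorm :: "real^'n^'m \<Rightarrow> real" where
  "mnorm M = onorm (\<lambda>x. M *v x)"

definition Linf :: "(int \<Rightarrow> real^'n^'m) \<Rightarrow> bool" where
  "Linf M \<longleftrightarrow> (\<exists>C. \<forall>n. mnorm (M n) \<le> C)"

definition Lya :: "(int \<Rightarrow> real^'d^'d) \<Rightarrow> bool" where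
  "Lya M \<longleftrightarrow> (\<forall>n. invertible (M n)) \<and> Linf M \<and> Linf (\<lambda>n. matrix_inv (M n))"

fun evol_fwd :: "(int \<Rightarrow> real^'d^'d) \<Rightarrow> int \<Rightarrow> nat \<Rightarrow> real^'d^'d" where
  "evol_fwd M n 0 = mat 1"
| "evol_fwd M n (Suc k) = M (n + int k) ** evol_fwd M n k"

fun evol_bwd :: "(int \<Rightarrow> real^'d^'d) \<Rightarrow> int \<Rightarrow> nat \<Rightarrow> real^'d^'d" where
  "evol_bwd M n 0 = mat 1"
| "evol_bwd M n (Suc k) = matrix_inv (M (n - int k - 1)) ** evol_bwd M n k"

definition evol :: "(int \<Rightarrow> real^'d^'d) \<Rightarrow> int \<Rightarrow> int \<Rightarrow> real^'d^'d" where
  "evol M m n = (if n \<le> m then evol_fwd M n (nat (m - n)) else evol_bwd M n (nat (n - m)))"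

definition has_ED :: "(int \<Rightarrow> real^'d^'d) \<Rightarrow> bool" where
  "has_ED M \<longleftrightarrow> (\<exists>K \<alpha> P. K > 0 \<and> \<alpha> > 0 \<and>
     (\<forall>n. P n ** P n = P n) \<and>
     (\<forall>m n. P m ** evol M m n = evol M m n ** P n) \<and>
     (\<forall>m n. n \<le> m \<longrightarrow> mnorm (evol M m n ** P n) \<le> K * exp (- \<alpha> * real_of_int (m - n))) \<and>
     (\<forall>m n. m \<le> n \<longrightarrow> mnorm (evol M m n ** (mat 1 - P n)) \<le> K * exp (\<alpha> * real_of_int (m - n))))"

definition ED_spectrum :: "(int \<Rightarrow> real^'d^'d) \<Rightarrow> real set" where
  "ED_spectrum M = {\<gamma>. \<not> has_ED (\<lambda>n. exp (- \<gamma>) *\<^sub>R M n)}"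

fun ctrl_state :: "(int \<Rightarrow> real^'d^'d) \<Rightarrow> (int \<Rightarrow> real^'s^'d) \<Rightarrow> (int \<Rightarrow> real^'s)
     \<Rightarrow> int \<Rightarrow> nat \<Rightarrow> real^'d" where
  "ctrl_state A B u k0 0 = 0"
| "ctrl_state A B u k0 (Suc j) = A (k0 + int j) *v ctrl_state A B u k0 j + B (k0 + int j) *v u (k0 + int j)"

definition UCC :: "(int \<Rightarrow> real^'d^'d) \<Rightarrow> (int \<Rightarrow> real^'s^'d) \<Rightarrow> bool" where
  "UCC A B \<longleftrightarrow> (\<exists>\<alpha>>0. \<exists>K::nat. \<forall>(\<xi>::real^'d) (k0::int). \<exists>u::int \<Rightarrow> real^'s.
      ctrl_state A B u k0 K = \<xi> \<and>
      (\<forall>n. k0 \<le> n \<and> n < k0 + int K \<longrightarrow> norm (u n) \<le> \<alpha> * norm \<xi>))"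

end

theory Submission
  imports Defs
begin

text \<open>
  Uniform complete controllability lets a bounded feedback realise any prescribed transition matrix
  over windows of a fixed length while keeping all intermediate transition matrices uniformly
  invertible.  Concatenating such windows, the closed loop can be made kinematically similar to an
  arbitrary Lyapunov sequence.  Kinematic similarity preserves the dichotomy spectrum, so it suffices
  to exhibit a diagonal system whose spectrum is the given union of intervals.
\<close>

section \<open>Matrix norms, inverses and determinants\<close>

text \<open>Controllability provides open-loop controls and says nothing about the states passed on
  the way, while a feedback of the form \<open>V ** matrix_inv X\<close> that reproduces such a
  control needs every intermediate state matrix \<open>X\<close> to be invertible, with bounds
  independent of the window. Invertibility is therefore measured by determinants: an upper bound on
  the inverse bounds the absolute determinant from below, the converse holds for bounded matrices,
  and along a line of matrices the determinant is a polynomial whose degree is at most the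
  dimension. A window contains finitely many times, so a finite grid of integer parameters, whose
  size depends only on the window length and the dimension, contains one at which all these
  determinants are quantitatively nonzero.\<close>

lemma matrix_inv_right_mult: "invertible M \<Longrightarrow> M ** matrix_inv M = mat 1"
  and matrix_inv_left_mult: "invertible M \<Longrightarrow> matrix_inv M ** M = mat 1"
  unfolding invertible_def matrix_inv_def by (metis (mono_tags, lifting) someI_ex)+

lemma matrix_inv_right_cancel:
  "invertible M \<Longrightarrow> X ** M ** matrix_inv M = X"
  "invertible M \<Longrightarrow> X ** matrix_inv M ** M = X"
  by (simp_all add: matrix_mul_assoc[symmetric] matrix_inv_right_mult matrix_inv_left_mult)

lemma matrix_inv_unique:
  fixes M :: "real^'n^'n"
  assumes "M ** N = mat 1"
  shows "invertible M" "matrix_inv M = N"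
proof -
  show M: "invertible M"
    using assms invertible_right_inverse by blast
  have "matrix_inv M = matrix_inv M ** M ** N"
    by (simp add: matrix_mul_assoc[symmetric] assms)
  then show "matrix_inv M = N"
    by (simp add: M matrix_inv_left_mult)
qed

lemma invertible_matrix_inv:
  fixes M :: "real^'n^'n"
  assumes "invertible M"
  shows "invertible (matrix_inv M)" "matrix_inv (matrix_inv M) = M"
  using matrix_inv_unique[OF matrix_inv_left_mult[OF assms]] by auto

lemma matrix_inv_mult:
  fixes M N :: "real^'n^'n"
  assumes "invertible M" "invertible N"
  shows "matrix_inv (M ** N) = matrix_inv N ** matrix_inv M"
  by (rule matrix_inv_unique)
    (simp add: assms matrix_mul_assoc matrix_inv_right_cancel matrix_inv_right_mult)

lemma matrix_inv_mat_1: "matrix_inv (mat 1 :: real^'n^'n) = mat 1"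
  by (rule matrix_inv_unique) simp

lemma invertible_mat_1: "invertible (mat 1 :: real^'n^'n)"
  by (rule matrix_inv_unique) (rule matrix_mul_lid)

lemma matrix_mult_add_left: "(A + B) ** C = A ** C + B ** (C :: real^'p^'n)"
  by (simp add: matrix_matrix_mult_def vec_eq_iff algebra_simps sum.distrib)

lemma matrix_mult_diff_left: "(A - B) ** C = A ** C - B ** (C :: real^'p^'n)"
  by (simp add: matrix_matrix_mult_def vec_eq_iff algebra_simps sum_subtractf)

lemma matrix_mult_diff_right: "A ** (B - C) = A ** B - A ** (C :: real^'p^'n)"
  by (simp add: matrix_matrix_mult_def vec_eq_iff algebra_simps sum_subtractf)

lemma column_mult: "column i (A ** B) = A *v column i B"
  by (simp add: column_def matrix_matrix_mult_def matrix_vector_mult_def vec_eq_iff)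

lemma column_add: "column i (A + B) = column i A + column i B"
  by (simp add: column_def vec_eq_iff)

lemma column_zero: "column i 0 = 0"
  by (simp add: column_def vec_eq_iff)

lemma matrix_eqI_column:
  assumes "\<And>i. column i A = column i B"
  shows "A = B"
  using assms by (simp add: column_def vec_eq_iff)

section \<open>Operator norm estimates\<close>

lemma mnorm_nonneg: "0 \<le> mnorm M"
  unfolding mnorm_def by (rule onorm_pos_le) simp

lemma mnorm_mult: "mnorm (M ** N) \<le> mnorm M * mnorm N"
proof -
  have "(\<lambda>x. (M ** N) *v x) = (*v) M \<circ> (*v) N"
    by (auto simp: matrix_vector_mul_assoc)
  then show ?thesis
    unfolding mnorm_def by (metis onorm_compose matrix_vector_mul_bounded_linear)
qed

lemma mnorm_mult_le:
  assumes "mnorm M \<le> a" "mnorm N \<le> b"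
  shows "mnorm (M ** N) \<le> a * b"
  using mnorm_mult[of M N] mult_mono[OF assms] assms mnorm_nonneg[of M] mnorm_nonneg[of N]
  by linarith

lemma mnorm_add: "mnorm (M + N) \<le> mnorm M + mnorm N"
  unfolding mnorm_def matrix_vector_mult_add_rdistrib by (intro onorm_triangle) simp_all

lemma mnorm_scaleR: "mnorm (k *\<^sub>R M) = \<bar>k\<bar> * mnorm M"
  unfolding mnorm_def scaleR_matrix_vector_assoc[symmetric] by (rule onorm_scaleR) simp

lemma mnorm_diff: "mnorm (M - N) \<le> mnorm M + mnorm N"
  using mnorm_add[of M "(-1) *\<^sub>R N"] mnorm_scaleR[of "-1" N] by simp

lemma mnorm_mat_1: "mnorm (mat 1 :: real^'n^'n) \<le> 1"
  unfolding mnorm_def by (rule onorm_le) simp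

lemma mnorm_zero: "mnorm 0 = 0"
  using mnorm_scaleR[of 0 0] by simp

lemma norm_le_mnorm: "norm (M *v x) \<le> mnorm M * norm x"
  unfolding mnorm_def by (rule onorm) simp

lemma norm_column_le_mnorm: "norm (column i M) \<le> mnorm M"
  unfolding mnorm_def by (rule norm_column_le_onorm)

lemma entry_le_mnorm: "\<bar>M $ i $ j\<bar> \<le> mnorm M"
  unfolding mnorm_def by (rule matrix_component_le_onorm)

lemma mnorm_le_entries:
  fixes M :: "real^'n^'m"
  shows "(\<And>i j. \<bar>M $ i $ j\<bar> \<le> c) \<Longrightarrow> mnorm M \<le> real CARD('m) * real CARD('n) * c"
  unfolding mnorm_def by (rule onorm_le_matrix_component)

section \<open>Determinants as a quantitative test of invertibility\<close>

lemma abs_det_le: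
  fixes M :: "real^'n^'n"
  assumes "\<And>i j. \<bar>M $ i $ j\<bar> \<le> c"
  shows "\<bar>det M\<bar> \<le> fact CARD('n) * c ^ CARD('n)"
proof -
  let ?P = "{p. p permutes (UNIV :: 'n set)}"
  have "\<bar>det M\<bar> \<le> (\<Sum>p\<in>?P. \<bar>of_int (sign p) * (\<Prod>i\<in>UNIV. M $ i $ p i)\<bar>)"
    unfolding det_def by (rule sum_abs)
  also have "\<dots> \<le> (\<Sum>p\<in>?P. c ^ CARD('n))"
  proof (rule sum_mono)
    fix p :: "'n \<Rightarrow> 'n"
    have "\<bar>real_of_int (sign p)\<bar> = 1"
      by (simp add: sign_def)
    moreover have "(\<Prod>i\<in>UNIV. \<bar>M $ i $ p i\<bar>) \<le> (\<Prod>i\<in>(UNIV::'n set). c)"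
      by (rule prod_mono) (simp add: assms)
    ultimately show "\<bar>of_int (sign p) * (\<Prod>i\<in>UNIV. M $ i $ p i)\<bar> \<le> c ^ CARD('n)"
      by (simp add: abs_mult abs_prod)
  qed
  also have "\<dots> = fact CARD('n) * c ^ CARD('n)"
    by (simp add: card_permutations)
  finally show ?thesis .
qed

text \<open>The determinants of \<open>M\<close> and of its inverse multiply to 1, so the Leibniz
  bound for the inverse turns into a lower bound for \<open>M\<close>.\<close>

lemma abs_det_ge:
  fixes M :: "real^'n^'n"
  assumes "invertible M" "mnorm (matrix_inv M) \<le> c" "c > 0"
  shows "1 / (fact CARD('n) * c ^ CARD('n)) \<le> \<bar>det M\<bar>"
proof -
  have "\<bar>det (matrix_inv M)\<bar> \<le> fact CARD('n) * c ^ CARD('n)"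
    by (rule abs_det_le) (meson assms entry_le_mnorm order_trans)
  moreover have "\<bar>det M\<bar> * \<bar>det (matrix_inv M)\<bar> = 1"
    using matrix_inv_right_mult[OF assms(1)] by (metis abs_mult abs_one det_I det_mul)
  ultimately have "1 \<le> \<bar>det M\<bar> * (fact CARD('n) * c ^ CARD('n))"
    by (metis abs_ge_zero mult_left_mono)
  then show ?thesis
    using assms(3) by (simp add: field_simps)
qed

text \<open>By Cramer's rule each entry of the inverse is a quotient of determinants, the numerator
  having one column replaced by a basis vector. The assumption \<open>1 \<le> c\<close> lets
  \<open>c\<close> bound the entries of that column as well.\<close>

lemma mnorm_matrix_inv_le:
  fixes M :: "real^'n^'n"
  assumes "mnorm M \<le> c" "1 \<le> c" "e \<le> \<bar>det M\<bar>" "0 < e"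
  shows "invertible M"
    "mnorm (matrix_inv M) \<le> real CARD('n) * real CARD('n) * (fact CARD('n) * c ^ CARD('n) / e)"
proof -
  have nz: "det M \<noteq> 0"
    using assms by auto
  then show inv: "invertible M"
    by (simp add: invertible_det_nz)
  show "mnorm (matrix_inv M) \<le> real CARD('n) * real CARD('n) * (fact CARD('n) * c ^ CARD('n) / e)"
  proof (rule mnorm_le_entries)
    fix i j
    let ?N = "(\<chi> k l. if l = i then axis j 1 $ k else M $ k $ l) :: real^'n^'n"
    have "M *v (matrix_inv M *v axis j 1) = axis j 1"
      by (simp add: matrix_vector_mul_assoc inv matrix_inv_right_mult)
    then have "(matrix_inv M *v axis j 1) $ i = det ?N / det M"
      by (simp only: cramer[OF nz]) simp
    then have "matrix_inv M $ i $ j = det ?N / det M"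
      by (simp add: matrix_vector_mult_basis column_def)
    moreover have "\<bar>det ?N\<bar> \<le> fact CARD('n) * c ^ CARD('n)"
    proof (rule abs_det_le)
      fix k l
      show "\<bar>?N $ k $ l\<bar> \<le> c"
        using assms(1,2) entry_le_mnorm[of M k l] by (auto simp: axis_def)
    qed
    ultimately show "\<bar>matrix_inv M $ i $ j\<bar> \<le> fact CARD('n) * c ^ CARD('n) / e"
      using assms by (simp add: abs_divide frac_le)
  qed
qed

text \<open>In the Leibniz formula every factor is affine in \<open>t\<close>. The degree bound,
  uniform in \<open>X\<close> and \<open>Y\<close>, fixes in advance how many parameters can be
  bad.\<close>

lemma det_affine_poly:
  fixes X Y :: "real^'n^'n"
  obtains p :: "real poly" where "degree p \<le> CARD('n)" "\<And>t. poly p t = det (X + t *\<^sub>R Y)"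
proof
  let ?P = "{p. p permutes (UNIV :: 'n set)}"
  let ?f = "\<lambda>q. smult (of_int (sign q)) (\<Prod>i\<in>UNIV. [:X $ i $ q i, Y $ i $ q i:])"
  show "degree (\<Sum>q\<in>?P. ?f q) \<le> CARD('n)"
  proof (rule degree_sum_le)
    fix q :: "'n \<Rightarrow> 'n"
    have "degree (\<Prod>i\<in>UNIV. [:X $ i $ q i, Y $ i $ q i:])
        \<le> sum (degree \<circ> (\<lambda>i. [:X $ i $ q i, Y $ i $ q i:])) UNIV"
      by (rule degree_prod_sum_le) simp
    also have "\<dots> \<le> (\<Sum>i\<in>(UNIV::'n set). 1)"
      by (rule sum_mono) simp
    finally show "degree (?f q) \<le> CARD('n)"
      using degree_smult_le[of "of_int (sign q)" "\<Prod>i\<in>UNIV. [:X $ i $ q i, Y $ i $ q i:]"] by simp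
  qed (simp add: finite_permutations)
  show "poly (\<Sum>q\<in>?P. ?f q) t = det (X + t *\<^sub>R Y)" for t
    by (simp add: det_def poly_sum poly_prod)
qed

section \<open>Simultaneous lower bounds for polynomials\<close>

text \<open>A polynomial that is small at more than \<open>d\<close> integers of
  \<open>{..N}\<close> is small on all of that range: interpolate at \<open>d + 1\<close> of these
  integers. Distinct integers are at least 1 apart, which keeps the interpolation weights below
  \<open>N ^ d\<close>.\<close>

lemma abs_poly_le_Lagrange:
  fixes p :: "real poly" and N x d :: nat
  assumes deg: "degree p \<le> d" and x: "x \<le> N"
    and many: "d < card {t \<in> {..N}. \<bar>poly p (real t)\<bar> < e}"
  shows "\<bar>poly p (real x)\<bar> \<le> real (Suc d) * (e * real N ^ d)"
proof -
  obtain I where I: "I \<subseteq> {t \<in> {..N}. \<bar>poly p (real t)\<bar> < e}" "card I = Suc d" "finite I"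
    using obtain_subset_with_card_n[of "Suc d"] many by (metis Suc_leI)
  \<comment> \<open>Lagrange basis polynomial of the node \<open>t\<close>: 1 at \<open>t\<close>
    and 0 at the other nodes.\<close>
  define L where "L t = (\<Prod>j\<in>I - {t}. smult (1 / (real t - real j)) [:- real j, 1:])" for t
  have cardI: "card (I - {t}) = d" if "t \<in> I" for t
    using I that by simp
  have degL: "degree (L t) \<le> d" if "t \<in> I" for t
  proof -
    have "degree (L t) \<le> (\<Sum>j\<in>I - {t}. 1)"
      unfolding L_def using I(3)
      by (intro order_trans[OF degree_prod_sum_le] sum_mono) auto
    then show ?thesis
      using cardI[OF that] by simp
  qed
  have L_node: "poly (L t) (real s) = (if s = t then 1 else 0)" if "s \<in> I" "t \<in> I" for s t
  proof (cases "s = t")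
    case True
    have "poly (L t) (real t) = (\<Prod>j\<in>I - {t}. 1)"
      unfolding L_def poly_prod by (intro prod.cong) (auto simp: diff_divide_distrib[symmetric])
    with True show ?thesis by simp
  next
    case False
    then show ?thesis
      using that I(3) by (auto simp: L_def poly_prod prod_zero_iff)
  qed
  \<comment> \<open>Both sides have degree at most \<open>d\<close> and agree at the
    \<open>d + 1\<close> nodes.\<close>
  have "p = (\<Sum>t\<in>I. smult (poly p (real t)) (L t))"
  proof (rule poly_eqI_degree)
    fix y assume "y \<in> real ` I"
    then obtain s where s: "s \<in> I" "y = real s" by auto
    have "(\<Sum>t\<in>I. poly p (real t) * poly (L t) (real s)) = (\<Sum>t\<in>I. if s = t then poly p (real t) else 0)"
      by (rule sum.cong) (auto simp: L_node s)
    then show "poly p y = poly (\<Sum>t\<in>I. smult (poly p (real t)) (L t)) y"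
      using s I(3) by (simp add: poly_sum)
  next
    have card: "card (real ` I) = Suc d"
      using I(2) by (simp add: card_image inj_on_def)
    show "degree p < card (real ` I)"
      using deg card by simp
    have "degree (\<Sum>t\<in>I. smult (poly p (real t)) (L t)) \<le> d"
      by (intro degree_sum_le) (use I(3) degL in \<open>auto intro: order_trans[OF degree_smult_le]\<close>)
    then show "degree (\<Sum>t\<in>I. smult (poly p (real t)) (L t)) < card (real ` I)"
      using card by simp
  qed
  then have "poly p (real x) = (\<Sum>t\<in>I. poly p (real t) * poly (L t) (real x))"
    by (metis (no_types, lifting) poly_smult poly_sum sum.cong)
  also have "\<bar>\<dots>\<bar> \<le> (\<Sum>t\<in>I. e * real N ^ d)"
  proof (rule order_trans[OF sum_abs sum_mono])
    fix t assume t: "t \<in> I"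
    have "\<bar>poly (L t) (real x)\<bar> = (\<Prod>j\<in>I - {t}. \<bar>(real x - real j) / (real t - real j)\<bar>)"
      by (simp add: L_def poly_prod abs_prod divide_simps)
    also have "\<dots> \<le> (\<Prod>j\<in>I - {t}. real N)"
    proof (rule prod_mono, safe)
      fix j assume j: "j \<in> I" "j \<noteq> t"
      have "\<bar>real x - real j\<bar> \<le> real N" "1 \<le> \<bar>real t - real j\<bar>"
        using j x I(1) by auto
      then have "\<bar>real x - real j\<bar> / \<bar>real t - real j\<bar> \<le> real N / 1"
        by (intro frac_le) auto
      then show "\<bar>(real x - real j) / (real t - real j)\<bar> \<le> real N"
        by (simp add: abs_divide)
    qed simp
    also have "\<dots> = real N ^ d"
      by (simp add: I(2) t)
    finally show "\<bar>poly p (real t) * poly (L t) (real x)\<bar> \<le> e * real N ^ d"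
      using I(1) t unfolding abs_mult by (intro mult_mono) auto
  qed
  also have "\<dots> = real (Suc d) * (e * real N ^ d)"
    by (simp add: I(2))
  finally show ?thesis .
qed

text \<open>Pigeonhole: a polynomial that reaches \<open>\<delta>\<close> somewhere on the grid is
  below the threshold at no more than \<open>d\<close> grid points. The \<open>m + 1\<close>
  polynomials thus exclude at most \<open>Suc m * d = N\<close> of the \<open>N + 1\<close> points.
  The places where they are large may differ from one polynomial to another.\<close>

lemma common_large_value:
  fixes p :: "nat \<Rightarrow> real poly" and d m N :: nat
  assumes d: "0 < d" and N: "N = Suc m * d" and \<delta>: "0 < \<delta>"
    and deg: "\<And>n. n \<le> m \<Longrightarrow> degree (p n) \<le> d"
    and large: "\<And>n. n \<le> m \<Longrightarrow> \<exists>x\<le>N. \<delta> \<le> \<bar>poly (p n) (real x)\<bar>"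
  obtains t where "t \<le> N"
    "\<And>n. n \<le> m \<Longrightarrow> \<delta> / (2 * (real (Suc d) * real N ^ d)) \<le> \<bar>poly (p n) (real t)\<bar>"
proof -
  \<comment> \<open>The threshold makes the interpolation bound equal to
    \<open>\<delta> / 2\<close>, in conflict with the value of size \<open>\<delta>\<close>.\<close>
  define e where "e = \<delta> / (2 * (real (Suc d) * real N ^ d))"
  define bad where "bad n = {t \<in> {..N}. \<bar>poly (p n) (real t)\<bar> < e}" for n
  have "N > 0"
    using d N by simp
  then have e: "real (Suc d) * (e * real N ^ d) = \<delta> / 2"
    unfolding e_def by (simp add: field_simps del: of_nat_Suc)
  have "card (bad n) \<le> d" if n: "n \<le> m" for n
  proof (rule ccontr)
    assume "\<not> card (bad n) \<le> d"
    moreover obtain x where x: "x \<le> N" "\<delta> \<le> \<bar>poly (p n) (real x)\<bar>"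
      using large[OF n] by auto
    ultimately have "\<bar>poly (p n) (real x)\<bar> \<le> \<delta> / 2"
      using abs_poly_le_Lagrange[OF deg[OF n] x(1), of e] unfolding bad_def e by linarith
    with x \<delta> show False by simp
  qed
  then have "card (\<Union>n\<in>{..m}. bad n) \<le> (\<Sum>n\<in>{..m}. d)"
    by (intro order_trans[OF card_UN_le] sum_mono) auto
  then have "card (\<Union>n\<in>{..m}. bad n) < card {..N}"
    by (simp add: N)
  moreover have "finite (\<Union>n\<in>{..m}. bad n)"
    by (simp add: bad_def)
  ultimately have "\<not> {..N} \<subseteq> (\<Union>n\<in>{..m}. bad n)"
    using card_mono[of "\<Union>n\<in>{..m}. bad n" "{..N}"] by linarith
  then obtain t where "t \<le> N" "t \<notin> (\<Union>n\<in>{..m}. bad n)"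
    by auto
  then show ?thesis
    using that[of t] by (fastforce simp: bad_def e_def)
qed

section \<open>Steering through uniformly invertible states\<close>

lemma LinfD:
  assumes "Linf M"
  obtains c where "1 \<le> c" "\<And>n. mnorm (M n) \<le> c"
  using assms unfolding Linf_def by (metis max.cobounded1 max.coboundedI2)

lemma LyaD:
  assumes "Lya M"
  obtains c where "1 \<le> c" "\<And>n. invertible (M n)" "\<And>n. mnorm (M n) \<le> c"
    "\<And>n. mnorm (matrix_inv (M n)) \<le> c"
proof -
  obtain c c' where "1 \<le> c" "\<And>n. mnorm (M n) \<le> c" "\<And>n. mnorm (matrix_inv (M n)) \<le> c'"
    using assms LinfD unfolding Lya_def by metis
  then show ?thesis
    using assms that[of "max c c'"] unfolding Lya_def by (simp add: le_max_iff_disj)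
qed

lemma evol_fwd_bounds:
  assumes "1 \<le> c" "\<And>n. invertible (M n)" "\<And>n. mnorm (M n) \<le> c"
    "\<And>n. mnorm (matrix_inv (M n)) \<le> c"
  shows "invertible (evol_fwd M k j)" "mnorm (evol_fwd M k j) \<le> c ^ j"
    "mnorm (matrix_inv (evol_fwd M k j)) \<le> c ^ j"
proof (induction j)
  case 0
  show "invertible (evol_fwd M k 0)" "mnorm (evol_fwd M k 0) \<le> c ^ 0"
    "mnorm (matrix_inv (evol_fwd M k 0)) \<le> c ^ 0"
    by (simp_all add: invertible_mat_1 matrix_inv_mat_1 mnorm_mat_1)
next
  case (Suc j)
  show "invertible (evol_fwd M k (Suc j))"
    by (simp add: invertible_mult assms Suc)
  show "mnorm (evol_fwd M k (Suc j)) \<le> c ^ Suc j"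
    by (simp add: mnorm_mult_le assms Suc)
  show "mnorm (matrix_inv (evol_fwd M k (Suc j))) \<le> c ^ Suc j"
    using mnorm_mult_le[OF Suc(3) assms(4)] by (simp add: matrix_inv_mult assms Suc mult.commute)
qed

text \<open>Column \<open>i\<close> is the trajectory of the control system started in column
  \<open>i\<close> of \<open>X\<close> and driven by the columns \<open>i\<close> of
  \<open>V\<close>. Started at \<open>mat 1\<close> with \<open>V j\<close> equal to a feedback gain
  times the current state, this is the transition matrix of the closed loop.\<close>

primrec matrix_state :: "(int \<Rightarrow> real^'d^'d) \<Rightarrow> (int \<Rightarrow> real^'s^'d) \<Rightarrow> int \<Rightarrow> (nat \<Rightarrow> real^'d^'s)
    \<Rightarrow> real^'d^'d \<Rightarrow> nat \<Rightarrow> real^'d^'d" where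
  "matrix_state A B k V X 0 = X"
| "matrix_state A B k V X (Suc j) =
    A (k + int j) ** matrix_state A B k V X j + B (k + int j) ** V j"

lemma matrix_state_cong:
  assumes "\<And>i. i < j \<Longrightarrow> V i = W i"
  shows "matrix_state A B k V X j = matrix_state A B k W X j"
  using assms by (induction j) auto

lemma matrix_state_add:
  "matrix_state A B k V X (i + j) =
    matrix_state A B (k + int i) (\<lambda>r. V (i + r)) (matrix_state A B k V X i) j"
  by (induction j) (auto simp: algebra_simps)

text \<open>Superposition. It serves both to separate the free motion from the effect of a control
  and to form affine combinations of two controlled trajectories.\<close>

lemma matrix_state_linear:
  "matrix_state A B k (\<lambda>i. V i + t *\<^sub>R W i) (X + t *\<^sub>R Y) j =
    matrix_state A B k V X j + t *\<^sub>R matrix_state A B k W Y j"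
  by (induction j)
    (auto simp: matrix_add_ldistrib matrix_scalar_ac scaleR_add_right scalar_matrix_assoc[symmetric])

lemma matrix_state_no_control:
  "matrix_state A B k (\<lambda>_. 0) X j = evol_fwd A k j ** X"
  by (induction j) (auto simp: matrix_mul_assoc)

lemma mnorm_matrix_state:
  assumes c: "1 \<le> c" "\<And>n. mnorm (A n) \<le> c" "\<And>n. mnorm (B n) \<le> c"
    and v: "mnorm X \<le> v" "\<And>i. i < j \<Longrightarrow> mnorm (V i) \<le> v"
  shows "mnorm (matrix_state A B k V X j) \<le> (2 * c) ^ j * v"
  using v(2)
proof (induction j)
  case 0
  then show ?case using v by simp
next
  case (Suc j)
  have v0: "0 \<le> v"
    using v(1) mnorm_nonneg[of X] by linarith
  have "mnorm (matrix_state A B k V X (Suc j)) \<le> c * ((2 * c) ^ j * v) + c * v"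
    using Suc by (auto intro!: order_trans[OF mnorm_add] add_mono mnorm_mult_le c)
  also have "c * v \<le> c * ((2 * c) ^ j * v)"
    using c(1) v0 one_le_power[of "2 * c" j] by (intro mult_left_mono) (auto simp: mult_le_cancel_right1)
  finally show ?case by (simp add: mult_ac)
qed

text \<open>Each column of \<open>G\<close> is reached by its own vector control; these controls are
  the columns of \<open>V\<close>.\<close>

lemma UCC_matrix_steering:
  fixes A :: "int \<Rightarrow> real^'d^'d" and B :: "int \<Rightarrow> real^'s^'d"
  assumes "UCC A B"
  obtains \<beta> K where "0 < \<beta>" "0 < K"
    "\<And>G k. \<exists>V. matrix_state A B k V 0 K = G \<and> (\<forall>j<K. mnorm (V j) \<le> \<beta> * mnorm G)"
proof -
  obtain \<alpha> K where \<alpha>: "0 < \<alpha>"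
    and u: "\<And>(\<xi>::real^'d) k. \<exists>u. ctrl_state A B u k K = \<xi> \<and>
      (\<forall>n. k \<le> n \<and> n < k + int K \<longrightarrow> norm (u n) \<le> \<alpha> * norm \<xi>)"
    using assms unfolding UCC_def by metis
  \<comment> \<open>In zero steps only the zero state is reachable.\<close>
  have "K \<noteq> 0"
  proof
    assume "K = 0"
    with u[where \<xi> = 1 and k = 0] show False by simp
  qed
  \<comment> \<open>The dimension factor converts an entrywise bound into an operator norm
    bound.\<close>
  define \<beta> where "\<beta> = real CARD('s) * real CARD('d) * \<alpha>"
  show ?thesis
  proof
    show "0 < \<beta>" "0 < K"
      using \<alpha> \<open>K \<noteq> 0\<close> by (simp_all add: \<beta>_def)
    fix G :: "real^'d^'d" and k
    have "\<forall>i. \<exists>u. ctrl_state A B u k K = column i G \<and>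
        (\<forall>n. k \<le> n \<and> n < k + int K \<longrightarrow> norm (u n) \<le> \<alpha> * norm (column i G))"
      using u by blast
    then obtain w where w: "\<And>i. ctrl_state A B (w i) k K = column i G"
        "\<And>i n. k \<le> n \<Longrightarrow> n < k + int K \<Longrightarrow> norm (w i n) \<le> \<alpha> * norm (column i G)"
      by metis
    define V :: "nat \<Rightarrow> real^'d^'s" where "V j = (\<chi> r i. w i (k + int j) $ r)" for j
    have "column i (V j) = w i (k + int j)" for i j
      by (simp add: V_def column_def vec_eq_iff)
    then have "column i (matrix_state A B k V 0 j) = ctrl_state A B (w i) k j" for i j
      by (induction j) (simp_all add: column_zero column_add column_mult)
    then have "matrix_state A B k V 0 K = G"
      by (intro matrix_eqI_column) (simp add: w)
    moreover have "mnorm (V j) \<le> \<beta> * mnorm G" if "j < K" for j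
    proof -
      have "\<bar>V j $ r $ i\<bar> \<le> \<alpha> * mnorm G" for r i
      proof -
        have "\<bar>V j $ r $ i\<bar> \<le> norm (w i (k + int j))"
          by (simp add: V_def component_le_norm_cart)
        also have "\<dots> \<le> \<alpha> * norm (column i G)"
          using that by (intro w) auto
        also have "\<dots> \<le> \<alpha> * mnorm G"
          using \<alpha> by (simp add: norm_column_le_mnorm)
        finally show ?thesis .
      qed
      then have "mnorm (V j) \<le> real CARD('s) * real CARD('d) * (\<alpha> * mnorm G)"
        by (rule mnorm_le_entries)
      then show ?thesis
        by (simp add: \<beta>_def mult.assoc)
    qed
    ultimately show "\<exists>V. matrix_state A B k V 0 K = G \<and> (\<forall>j<K. mnorm (V j) \<le> \<beta> * mnorm G)"
      by blast
  qed
qed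

text \<open>
  Two explicit controls steer the identity to \<open>H\<close> in \<open>2 K\<close> steps: one is idle first, so its
  states are invertible up to time \<open>K\<close>; the other is idle last, so its states are invertible from
  time \<open>K\<close> on.  Every affine combination of them also reaches \<open>H\<close>, and the determinants of its
  states are polynomials in the parameter, none of which is identically small.
\<close>

lemma uniform_invertible_steering:
  fixes A :: "int \<Rightarrow> real^'d^'d" and B :: "int \<Rightarrow> real^'s^'d"
  assumes "Lya A" "Linf B" "UCC A B"
  obtains T where "0 < T"
    "\<And>h. \<exists>C. \<forall>k H. invertible H \<and> mnorm H \<le> h \<and> mnorm (matrix_inv H) \<le> h \<longrightarrow>
      (\<exists>V. matrix_state A B k V (mat 1) T = H \<and>
        (\<forall>j\<le>T. mnorm (V j) \<le> C \<and> invertible (matrix_state A B k V (mat 1) j) \<and>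
          mnorm (matrix_state A B k V (mat 1) j) \<le> C \<and>
          mnorm (matrix_inv (matrix_state A B k V (mat 1) j)) \<le> C))"
proof -
  obtain cA where cA: "1 \<le> cA" and invA: "\<And>n. invertible (A n)" and
    cA': "\<And>n. mnorm (A n) \<le> cA" "\<And>n. mnorm (matrix_inv (A n)) \<le> cA"
    using LyaD[OF assms(1)] by metis
  obtain cB where cB: "\<And>n. mnorm (B n) \<le> cB"
    using LinfD[OF assms(2)] by metis
  define c where "c = max cA cB"
  have c: "1 \<le> c" "\<And>n. mnorm (A n) \<le> c" "\<And>n. mnorm (matrix_inv (A n)) \<le> c" "\<And>n. mnorm (B n) \<le> c"
    using cA cA' cB by (auto simp: c_def le_max_iff_disj)
  note E = evol_fwd_bounds[where M = A, OF c(1) invA c(2,3)]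
  obtain \<beta> K where \<beta>: "0 < \<beta>" and K: "0 < K" and
    steer: "\<And>G k. \<exists>V. matrix_state A B k V 0 K = G \<and> (\<forall>j<K. mnorm (V j) \<le> \<beta> * mnorm G)"
    using UCC_matrix_steering[OF assms(3)] by metis
  define d where "d = CARD('d)"
  define N where "N = Suc (K + K) * d"
  \<comment> \<open>The window length depends on the system only; the size \<open>h0\<close> of the
    target enters just the bound \<open>C\<close>.\<close>
  show ?thesis
  proof (rule that[of "K + K"])
    show "0 < K + K" using K by simp
    fix h0 :: real
    define h where "h = max 1 h0"
    have h: "1 \<le> h" "h0 \<le> h" by (simp_all add: h_def)
    \<comment> \<open>\<open>g\<close> dominates the targets and the free transitions in a window,
      with their inverses; \<open>v\<close> bounds the two explicit controls,
      \<open>\<delta>\<close> their determinants from below where they are known to be invertible.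
      \<open>\<epsilon>\<close> is what remains of \<open>\<delta>\<close> at the common parameter,
      \<open>w\<close> bounds the combined control for parameters up to \<open>N\<close>, and
      \<open>C1\<close>, \<open>C2\<close> bound its states and their inverses.\<close>
    define g where "g = h * c ^ (K + K)"
    define v where "v = \<beta> * (2 * g)"
    define \<delta> where "\<delta> = 1 / (fact d * g ^ d)"
    define \<epsilon> where "\<epsilon> = \<delta> / (2 * (real (Suc d) * real N ^ d))"
    define w where "w = v + real N * (v + v)"
    define C1 where "C1 = (2 * c) ^ (K + K) * max 1 w"
    define C2 where "C2 = real d * real d * (fact d * C1 ^ d / \<epsilon>)"
    define C where "C = max (max w C1) C2"
    have pow: "c ^ i \<le> c ^ j" if "i \<le> j" for i j
      using that c by (intro power_increasing) auto
    have c1: "1 \<le> c ^ i" for i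
      using c by (intro one_le_power)
    have g: "1 \<le> g" "h \<le> g" "\<And>i. i \<le> K + K \<Longrightarrow> c ^ i \<le> g"
    proof -
      show "h \<le> g"
        using c1[of "K + K"] h unfolding g_def by (simp add: mult_le_cancel_left1)
      then show "1 \<le> g" using h by linarith
      fix i assume "i \<le> K + K"
      then have "1 * c ^ i \<le> h * c ^ (K + K)"
        using h c by (intro mult_mono pow) auto
      then show "c ^ i \<le> g" by (simp add: g_def)
    qed
    have v: "0 \<le> v" using \<beta> g by (simp add: v_def)
    have d: "0 < d" by (simp add: d_def)
    then have N: "0 < N" by (simp add: N_def)
    have \<delta>: "0 < \<delta>" using g by (simp add: \<delta>_def)
    have \<epsilon>: "0 < \<epsilon>" using \<delta> N by (simp add: \<epsilon>_def)
    have C1: "1 \<le> C1"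
    proof -
      have "1 * 1 \<le> (2 * c) ^ (K + K) * max 1 w"
        using c by (intro mult_mono one_le_power) auto
      then show ?thesis by (simp add: C1_def)
    qed
    show "\<exists>C. \<forall>k H. invertible H \<and> mnorm H \<le> h0 \<and> mnorm (matrix_inv H) \<le> h0 \<longrightarrow>
      (\<exists>V. matrix_state A B k V (mat 1) (K + K) = H \<and>
        (\<forall>j\<le>K + K. mnorm (V j) \<le> C \<and> invertible (matrix_state A B k V (mat 1) j) \<and>
          mnorm (matrix_state A B k V (mat 1) j) \<le> C \<and>
          mnorm (matrix_inv (matrix_state A B k V (mat 1) j)) \<le> C))"
    proof (intro exI[of _ C] allI impI, elim conjE)
      fix k and H :: "real^'d^'d"
      assume invH: "invertible H" and "mnorm H \<le> h0" "mnorm (matrix_inv H) \<le> h0"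
      then have H: "mnorm H \<le> h" "mnorm (matrix_inv H) \<le> h"
        using h by linarith+
      define \<Phi> where "\<Phi> j = evol_fwd A k j" for j
      define \<Psi> where "\<Psi> = evol_fwd A (k + int K) K"
      let ?S = "matrix_state A B k"
      have large: "\<delta> \<le> \<bar>det M\<bar>" if "invertible M" "mnorm (matrix_inv M) \<le> g" for M :: "real^'d^'d"
        using abs_det_ge[OF that] g by (simp add: \<delta>_def d_def)

      \<comment> \<open>The part of \<open>H\<close> that the free motion misses, to be produced
        from the zero state during the second half.\<close>
      define G1 where "G1 = H - \<Phi> (K + K)"
      obtain W1 where W1: "matrix_state A B (k + int K) W1 0 K = G1" "\<And>j. j < K \<Longrightarrow> mnorm (W1 j) \<le> \<beta> * mnorm G1"
        using steer by metis
      have G1: "mnorm G1 \<le> 2 * g"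
        using mnorm_diff[of H "\<Phi> (K + K)"] H E(2)[of k "K + K"] g(2) g(3)[of "K + K"]
        unfolding G1_def \<Phi>_def by linarith
      \<comment> \<open>Steering bounds \<open>W1\<close> only before its final time, whereas the
        claimed bound includes \<open>j = K + K\<close>; hence the value 0 from there on.\<close>
      define V1 where "V1 j = (if j < K \<or> K + K \<le> j then 0 else W1 (j - K))" for j
      have V1: "mnorm (V1 j) \<le> v" for j
      proof (cases "j < K \<or> K + K \<le> j")
        case True
        then show ?thesis using v by (simp add: V1_def mnorm_zero)
      next
        case False
        then have "mnorm (V1 j) \<le> \<beta> * mnorm G1"
          by (auto simp: V1_def intro!: W1)
        also have "\<dots> \<le> v"
          using G1 \<beta> by (simp add: v_def)
        finally show ?thesis .
      qed
      have S1_early: "?S V1 X j = evol_fwd A k j ** X" if "j \<le> K" for j X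
        using matrix_state_cong[of j V1 "\<lambda>_. 0" A B k X] that
        by (simp add: V1_def matrix_state_no_control)
      have S1_end: "?S V1 (mat 1) (K + K) = H"
      proof -
        have "?S V1 0 (K + K) = matrix_state A B (k + int K) (\<lambda>r. V1 (K + r)) 0 K"
          by (simp add: matrix_state_add S1_early)
        also have "\<dots> = G1"
          using W1(1) matrix_state_cong[of K "\<lambda>r. V1 (K + r)" W1] by (simp add: V1_def)
        finally have "?S V1 0 (K + K) = G1" .
        moreover have "?S V1 (mat 1) (K + K) = ?S (\<lambda>_. 0) (mat 1) (K + K) + ?S V1 0 (K + K)"
          using matrix_state_linear[of A B k "\<lambda>_. 0" 1 V1 "mat 1" 0 "K + K"] by simp
        ultimately show ?thesis
          by (simp add: G1_def \<Phi>_def matrix_state_no_control)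
      qed

      \<comment> \<open>The state required at time \<open>K\<close> is
        \<open>matrix_inv \<Psi> ** H\<close>, which the free motion of the second half carries to
        \<open>H\<close>; \<open>G2\<close> is its difference from the free motion of the first
        half.\<close>
      define G2 where "G2 = matrix_inv \<Psi> ** H - \<Phi> K"
      obtain W2 where W2: "?S W2 0 K = G2" "\<And>j. j < K \<Longrightarrow> mnorm (W2 j) \<le> \<beta> * mnorm G2"
        using steer by metis
      have "mnorm (matrix_inv \<Psi> ** H) \<le> g"
      proof -
        have "mnorm (matrix_inv \<Psi> ** H) \<le> c ^ K * h"
          unfolding \<Psi>_def by (intro mnorm_mult_le E H)
        also have "\<dots> \<le> g"
          using pow[of K "K + K"] h unfolding g_def by (simp add: mult.commute)
        finally show ?thesis .
      qed
      then have G2: "mnorm G2 \<le> 2 * g"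
        using mnorm_diff[of "matrix_inv \<Psi> ** H" "\<Phi> K"] E(2)[of k K] g(3)[of K]
        unfolding G2_def \<Phi>_def by linarith
      define V2 where "V2 j = (if j < K then W2 j else 0)" for j
      have V2: "mnorm (V2 j) \<le> v" for j
      proof (cases "j < K")
        case False
        then show ?thesis using v by (simp add: V2_def mnorm_zero)
      next
        case True
        then have "mnorm (V2 j) \<le> \<beta> * mnorm G2"
          by (auto simp: V2_def intro!: W2)
        also have "\<dots> \<le> v"
          using G2 \<beta> by (simp add: v_def)
        finally show ?thesis .
      qed
      have S2_K: "?S V2 (mat 1) K = matrix_inv \<Psi> ** H"
      proof -
        have "?S V2 (mat 1) K = ?S (\<lambda>_. 0) (mat 1) K + ?S V2 0 K"
          using matrix_state_linear[of A B k "\<lambda>_. 0" 1 V2 "mat 1" 0 K] by simp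
        moreover have "?S V2 0 K = G2"
          using W2(1) matrix_state_cong[of K V2 W2] by (simp add: V2_def)
        ultimately show ?thesis
          by (simp add: G2_def \<Phi>_def matrix_state_no_control)
      qed
      have S2_late: "?S V2 (mat 1) (K + j) = evol_fwd A (k + int K) j ** matrix_inv \<Psi> ** H" for j
        by (simp add: matrix_state_add S2_K V2_def matrix_state_no_control matrix_mul_assoc)
      have inv\<Psi>: "invertible \<Psi>"
        unfolding \<Psi>_def by (rule E)
      have S2_end: "?S V2 (mat 1) (K + K) = H"
        using inv\<Psi> by (simp add: S2_late matrix_inv_right_mult flip: \<Psi>_def)

      define X1 X2 where "X1 = ?S V1 (mat 1)" and "X2 = ?S V2 (mat 1)"
      have X1: "\<delta> \<le> \<bar>det (X1 j)\<bar>" if "j \<le> K" for j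
        unfolding X1_def S1_early[OF that] matrix_mul_rid
        using E(3)[of k j] g(3)[of j] that by (intro large E(1)) linarith
      have X2: "\<delta> \<le> \<bar>det (X2 (K + j))\<bar>" if "j \<le> K" for j
        unfolding X2_def S2_late
      proof (rule large)
        show inv: "invertible (evol_fwd A (k + int K) j ** matrix_inv \<Psi> ** H)"
          by (intro invertible_mult E invH invertible_matrix_inv inv\<Psi>)
        have "matrix_inv (evol_fwd A (k + int K) j ** matrix_inv \<Psi> ** H)
            = matrix_inv H ** (\<Psi> ** matrix_inv (evol_fwd A (k + int K) j))"
          by (simp add: matrix_inv_mult invertible_mult E invH invertible_matrix_inv inv\<Psi>)
        moreover have "mnorm \<dots> \<le> h * (c ^ K * c ^ j)"
          unfolding \<Psi>_def by (intro mnorm_mult_le E H)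
        moreover have "h * (c ^ K * c ^ j) \<le> g"
          using pow[of "K + j" "K + K"] that h
          by (simp add: g_def power_add)
        ultimately show "mnorm (matrix_inv (evol_fwd A (k + int K) j ** matrix_inv \<Psi> ** H)) \<le> g"
          by simp
      qed

      have "\<forall>j. \<exists>p. degree p \<le> d \<and> (\<forall>t. poly p t = det (X1 j + t *\<^sub>R (X2 j - X1 j)))"
        unfolding d_def by (metis det_affine_poly)
      then obtain p where p: "\<And>j. degree (p j) \<le> d"
          "\<And>j t. poly (p j) t = det (X1 j + t *\<^sub>R (X2 j - X1 j))"
        by metis
      \<comment> \<open>Parameter 0 gives \<open>X1\<close>, controlled up to time \<open>K\<close>;
        parameter 1 gives \<open>X2\<close>, controlled from then on.\<close>
      have "\<exists>x\<le>N. \<delta> \<le> \<bar>poly (p j) (real x)\<bar>" if j: "j \<le> K + K" for j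
      proof (cases "j \<le> K")
        case True
        then show ?thesis
          by (intro exI[of _ 0]) (simp add: p X1)
      next
        case False
        then show ?thesis
          using X2[of "j - K"] j N by (intro exI[of _ 1]) (simp add: p)
      qed
      then obtain t where t: "t \<le> N" "\<And>j. j \<le> K + K \<Longrightarrow> \<epsilon> \<le> \<bar>poly (p j) (real t)\<bar>"
        using common_large_value[of d N "K + K" \<delta> p] d \<delta> p unfolding N_def \<epsilon>_def by metis
      \<comment> \<open>The difference of the controls acts from the zero state, so every
        combination still starts at \<open>mat 1\<close>.\<close>
      define V where "V j = V1 j + real t *\<^sub>R (V2 j + (-1) *\<^sub>R V1 j)" for j
      have X: "?S V (mat 1) j = X1 j + real t *\<^sub>R (X2 j - X1 j)" for j
        using matrix_state_linear[of A B k V2 "-1" V1 "mat 1" "mat 1" j]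
          matrix_state_linear[of A B k V1 "real t" "\<lambda>j. V2 j + (-1) *\<^sub>R V1 j" "mat 1" 0 j]
        by (simp add: V_def[abs_def] X1_def X2_def)
      have Vw: "mnorm (V j) \<le> w" for j
      proof -
        have "mnorm (V2 j + (-1) *\<^sub>R V1 j) \<le> v + v"
          using mnorm_diff[of "V2 j" "V1 j"] V1[of j] V2[of j] by simp
        then have "real t * mnorm (V2 j + (-1) *\<^sub>R V1 j) \<le> real N * (v + v)"
          using t(1) by (intro mult_mono) (auto simp: mnorm_nonneg)
        then show ?thesis
          using mnorm_add[of "V1 j" "real t *\<^sub>R (V2 j + (-1) *\<^sub>R V1 j)"] V1[of j]
          unfolding V_def w_def mnorm_scaleR by simp
      qed
      show "\<exists>V. ?S V (mat 1) (K + K) = H \<and>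
        (\<forall>j\<le>K + K. mnorm (V j) \<le> C \<and> invertible (?S V (mat 1) j) \<and>
          mnorm (?S V (mat 1) j) \<le> C \<and> mnorm (matrix_inv (?S V (mat 1) j)) \<le> C)"
      proof (intro exI[of _ V] conjI allI impI)
        show "?S V (mat 1) (K + K) = H"
          unfolding X using S1_end S2_end by (simp add: X1_def X2_def)
        fix j assume j: "j \<le> K + K"
        show "mnorm (V j) \<le> C"
          using Vw[of j] by (simp add: C_def)
        have "mnorm (?S V (mat 1) j) \<le> (2 * c) ^ j * max 1 w"
          by (rule mnorm_matrix_state) (use c Vw mnorm_mat_1 in \<open>auto simp: le_max_iff_disj\<close>)
        also have "\<dots> \<le> C1"
          unfolding C1_def using c j by (intro mult_right_mono power_increasing) auto
        finally have 1: "mnorm (?S V (mat 1) j) \<le> C1" .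
        then show "mnorm (?S V (mat 1) j) \<le> C"
          by (simp add: C_def)
        have 2: "\<epsilon> \<le> \<bar>det (?S V (mat 1) j)\<bar>"
          using t(2)[OF j] by (simp add: p X)
        show "invertible (?S V (mat 1) j)"
          by (rule mnorm_matrix_inv_le[OF 1 C1 2 \<epsilon>])
        have "mnorm (matrix_inv (?S V (mat 1) j)) \<le> C2"
          using mnorm_matrix_inv_le(2)[OF 1 C1 2 \<epsilon>] by (simp add: C2_def d_def)
        then show "mnorm (matrix_inv (?S V (mat 1) j)) \<le> C"
          by (simp add: C_def)
      qed
    qed
  qed
qed

text \<open>On a window, \<open>X\<close> and \<open>F\<close> are the transition matrices from its
  start of the closed loop and of \<open>D\<close>. The transformation
  \<open>S = X ** matrix_inv F\<close> compares them and is reset to the identity at every window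
  start, so its bounds do not accumulate.\<close>

theorem global_Lyapunov_reducibility:
  fixes A D :: "int \<Rightarrow> real^'d^'d" and B :: "int \<Rightarrow> real^'s^'d"
  assumes "Lya A" "Linf B" "UCC A B" "Lya D"
  obtains U S where "Linf U" "Lya S"
    "\<And>n. A n + B n ** U n = S (n + 1) ** D n ** matrix_inv (S n)"
proof -
  obtain c where c: "1 \<le> c" "\<And>n. invertible (D n)" "\<And>n. mnorm (D n) \<le> c"
    "\<And>n. mnorm (matrix_inv (D n)) \<le> c"
    using LyaD[OF assms(4)] by metis
  note E = evol_fwd_bounds[where M = D, OF c]
  obtain T where T: "0 < T" and steer:
    "\<And>h. \<exists>C. \<forall>k H. invertible H \<and> mnorm H \<le> h \<and> mnorm (matrix_inv H) \<le> h \<longrightarrow>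
      (\<exists>V. matrix_state A B k V (mat 1) T = H \<and>
        (\<forall>j\<le>T. mnorm (V j) \<le> C \<and> invertible (matrix_state A B k V (mat 1) j) \<and>
          mnorm (matrix_state A B k V (mat 1) j) \<le> C \<and>
          mnorm (matrix_inv (matrix_state A B k V (mat 1) j)) \<le> C))"
    using uniform_invertible_steering[OF assms(1-3)] by metis
  \<comment> \<open>The targets and their inverses are bounded by \<open>c ^ T\<close> for every
    window, so one \<open>C\<close> serves all of them.\<close>
  obtain C where "\<forall>k. \<exists>V. matrix_state A B k V (mat 1) T = evol_fwd D k T \<and>
        (\<forall>j\<le>T. mnorm (V j) \<le> C \<and> invertible (matrix_state A B k V (mat 1) j) \<and>
          mnorm (matrix_state A B k V (mat 1) j) \<le> C \<and>
          mnorm (matrix_inv (matrix_state A B k V (mat 1) j)) \<le> C)"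
    using steer[of "c ^ T"] E[of _ T] by blast
  then obtain V where V: "\<And>k. matrix_state A B k (V k) (mat 1) T = evol_fwd D k T"
    "\<And>k j. j \<le> T \<Longrightarrow> mnorm (V k j) \<le> C"
    "\<And>k j. j \<le> T \<Longrightarrow> invertible (matrix_state A B k (V k) (mat 1) j)"
    "\<And>k j. j \<le> T \<Longrightarrow> mnorm (matrix_state A B k (V k) (mat 1) j) \<le> C"
    "\<And>k j. j \<le> T \<Longrightarrow> mnorm (matrix_inv (matrix_state A B k (V k) (mat 1) j)) \<le> C"
    by metis
  \<comment> \<open>Start of the window containing \<open>n\<close>, and offset in it; rounding down
    makes the windows tile the negative times too.\<close>
  define k where "k n = int T * (n div int T)" for n
  define r where "r n = nat (n mod int T)" for n
  define X where "X k j = matrix_state A B k (V k) (mat 1) j" for k j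
  define F where "F k j = evol_fwd D k j" for k j
  define S where "S n = X (k n) (r n) ** matrix_inv (F (k n) (r n))" for n
  define U where "U n = V (k n) (r n) ** matrix_inv (X (k n) (r n))" for n
  have n: "n = k n + int (r n)" for n
    using T by (simp add: k_def r_def)
  have r: "r n < T" for n
    using T by (simp add: r_def nat_less_iff)
  have invX: "invertible (X (k n) j)" if "j \<le> T" for n j
    using V that by (simp add: X_def)
  have invF: "invertible (F k j)" for k j
    using E by (simp add: F_def)
  have cT: "c ^ r n \<le> c ^ T" for n
    using c(1) r[of n] by (intro power_increasing) auto
  \<comment> \<open>The offset \<open>Suc (r n)\<close> may equal \<open>T\<close>, where
    \<open>S\<close> already belongs to the next window. Both sides are then \<open>mat 1\<close>,
    because steering makes \<open>X\<close> and \<open>F\<close> agree at the window end.\<close>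
  have S_next: "S (n + 1) = X (k n) (Suc (r n)) ** matrix_inv (F (k n) (Suc (r n)))" for n
  proof (cases "Suc (r n) < T")
    case True
    have "(n + 1) div int T = n div int T" "(n + 1) mod int T = n mod int T + 1"
      using True T n[of n]
      by (auto simp: r_def intro!: int_div_pos_eq[of _ _ _ "n mod int T + 1"] int_mod_pos_eq[of _ _ "n div int T"])
    then have "k (n + 1) = k n" "r (n + 1) = Suc (r n)"
      using T by (auto simp: k_def r_def nat_add_distrib)
    then show ?thesis
      by (simp add: S_def)
  next
    case False
    then have eq: "Suc (r n) = T"
      using r[of n] by simp
    then have "n + 1 = int T * (n div int T + 1)"
      using n[of n] by (auto simp: k_def algebra_simps)
    then have "r (n + 1) = 0"
      by (simp add: r_def)
    then have "S (n + 1) = mat 1"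
      by (simp add: S_def X_def F_def matrix_inv_mat_1)
    moreover have "X (k n) T = F (k n) T"
      by (simp add: X_def F_def V)
    ultimately show ?thesis
      using eq invF by (simp add: matrix_inv_right_mult)
  qed
  have "A n + B n ** U n = S (n + 1) ** D n ** matrix_inv (S n)" for n
  proof -
    let ?X = "X (k n) (r n)" and ?F = "F (k n) (r n)"
    have iX: "invertible ?X"
      using r[of n] by (intro invX) auto
    have "X (k n) (Suc (r n)) = A n ** ?X + B n ** V (k n) (r n)"
      unfolding X_def using n[of n] by simp
    also have "\<dots> = (A n + B n ** U n) ** ?X"
      using iX by (simp add: U_def matrix_mult_add_left matrix_mul_assoc matrix_inv_right_cancel)
    finally have 1: "X (k n) (Suc (r n)) ** matrix_inv ?X = A n + B n ** U n"
      using iX by (simp add: matrix_inv_right_cancel)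
    have 2: "F (k n) (Suc (r n)) = D n ** ?F"
      unfolding F_def using n[of n] by simp
    have 3: "matrix_inv (S n) = ?F ** matrix_inv ?X"
      using iX invF by (simp add: S_def matrix_inv_mult invertible_matrix_inv)
    have "S (n + 1) ** D n ** matrix_inv (S n) =
        X (k n) (Suc (r n)) ** matrix_inv (F (k n) (Suc (r n))) ** F (k n) (Suc (r n)) ** matrix_inv ?X"
      unfolding S_next 3 by (simp add: 2 matrix_mul_assoc)
    then show ?thesis
      using 1 invF by (simp add: matrix_inv_right_cancel)
  qed
  moreover have "Linf U"
    unfolding Linf_def U_def X_def
    by (intro exI[of _ "C * C"] allI mnorm_mult_le V less_imp_le r)
  moreover have "Lya S"
  proof -
    have iX: "invertible (X (k n) (r n))" for n
      by (intro invX less_imp_le r)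
    have "invertible (S n)" for n
      unfolding S_def by (intro invertible_mult iX invertible_matrix_inv invF)
    moreover have "mnorm (S n) \<le> C * c ^ T" for n
      unfolding S_def X_def F_def
      by (intro mnorm_mult_le V less_imp_le r order_trans[OF E(3) cT])
    moreover have "matrix_inv (S n) = F (k n) (r n) ** matrix_inv (X (k n) (r n))" for n
      using iX invF by (simp add: S_def matrix_inv_mult invertible_matrix_inv)
    moreover have "mnorm (F (k n) (r n) ** matrix_inv (X (k n) (r n))) \<le> c ^ T * C" for n
      unfolding X_def F_def
      by (intro mnorm_mult_le V less_imp_le r order_trans[OF E(2) cT])
    ultimately show ?thesis
      unfolding Lya_def Linf_def by metis
  qed
  ultimately show ?thesis
    using that by blast
qed

section \<open>Exponential dichotomy under kinematic similarity\<close>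

lemma evol_similarity:
  fixes M D S :: "int \<Rightarrow> real^'d^'d"
  assumes S: "\<And>n. invertible (S n)" and D: "\<And>n. invertible (D n)"
    and M: "\<And>n. M n = S (n + 1) ** D n ** matrix_inv (S n)"
  shows "evol M m n = S m ** evol D m n ** matrix_inv (S n)"
proof -
  have "evol_fwd M n j = S (n + int j) ** evol_fwd D n j ** matrix_inv (S n)" for j
    by (induction j)
      (simp_all add: M S matrix_inv_right_mult matrix_mul_assoc matrix_inv_right_cancel add.assoc add.commute[of 1])
  moreover have "evol_bwd M n j = S (n - int j) ** evol_bwd D n j ** matrix_inv (S n)" for j
  proof (induction j)
    case (Suc j)
    have "matrix_inv (M i) = S i ** matrix_inv (D i) ** matrix_inv (S (i + 1))" for i
      by (simp add: M S D matrix_inv_mult invertible_mult invertible_matrix_inv matrix_mul_assoc)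
    from this[of "n - int j - 1"] show ?case
      by (simp add: Suc.IH S matrix_mul_assoc matrix_inv_right_cancel algebra_simps)
  qed (simp add: S matrix_inv_right_mult)
  ultimately show ?thesis
    by (auto simp: evol_def)
qed

text \<open>Conjugating the projections by \<open>S\<close> keeps the rate and costs only the bounds
  of \<open>S\<close> and its inverse in the constant.\<close>

lemma has_ED_similarity:
  fixes M D S :: "int \<Rightarrow> real^'d^'d"
  assumes "Lya S" and D: "\<And>n. invertible (D n)"
    and M: "\<And>n. M n = S (n + 1) ** D n ** matrix_inv (S n)"
    and "has_ED D"
  shows "has_ED M"
proof -
  obtain c where c: "1 \<le> c" and S: "\<And>n. invertible (S n)" and Sc: "\<And>n. mnorm (S n) \<le> c"
    "\<And>n. mnorm (matrix_inv (S n)) \<le> c"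
    using LyaD[OF assms(1)] by metis
  obtain K \<alpha> P where K: "K > 0" "\<alpha> > 0" and P: "\<And>n. P n ** P n = P n"
    "\<And>m n. P m ** evol D m n = evol D m n ** P n"
    "\<And>m n. n \<le> m \<Longrightarrow> mnorm (evol D m n ** P n) \<le> K * exp (- \<alpha> * real_of_int (m - n))"
    "\<And>m n. m \<le> n \<Longrightarrow> mnorm (evol D m n ** (mat 1 - P n)) \<le> K * exp (\<alpha> * real_of_int (m - n))"
    using \<open>has_ED D\<close> unfolding has_ED_def by metis
  define Q where "Q n = S n ** P n ** matrix_inv (S n)" for n
  note evol = evol_similarity[where M = M and S = S and D = D, OF S D M]
  note cancel = matrix_mul_assoc matrix_inv_right_cancel[OF S]
  have mat1: "mat 1 - Q n = S n ** (mat 1 - P n) ** matrix_inv (S n)" for n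
    by (simp add: Q_def matrix_mult_diff_left matrix_mult_diff_right matrix_inv_right_mult S)
  have bound: "mnorm (S m ** X ** matrix_inv (S n)) \<le> c * b * c" if "mnorm X \<le> b" for m n b X
    by (intro mnorm_mult_le Sc that)
  show ?thesis
    unfolding has_ED_def
  proof (rule exI[of _ "c * K * c"], rule exI[of _ \<alpha>], rule exI[of _ Q], intro conjI allI impI)
    show "0 < c * K * c" "0 < \<alpha>"
      using c K by auto
    show "Q n ** Q n = Q n" for n
      using P(1)[of n] by (simp add: Q_def cancel) (simp add: matrix_mul_assoc[symmetric])
    show "Q m ** evol M m n = evol M m n ** Q n" for m n
      using P(2)[of m n] by (simp add: Q_def evol cancel) (metis matrix_mul_assoc)
    show "mnorm (evol M m n ** Q n) \<le> c * K * c * exp (- \<alpha> * real_of_int (m - n))" if "n \<le> m" for m n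
      using bound[OF P(3)[OF that], of m n] by (simp add: evol Q_def cancel mult_ac)
    show "mnorm (evol M m n ** (mat 1 - Q n)) \<le> c * K * c * exp (\<alpha> * real_of_int (m - n))" if "m \<le> n" for m n
      using bound[OF P(4)[OF that], of m n] by (simp add: evol mat1 cancel mult_ac)
  qed
qed

text \<open>The scalar \<open>exp (- \<gamma>)\<close> commutes with the similarity, and the inverse
  transformation gives the converse implication.\<close>

lemma ED_spectrum_similarity:
  fixes M D S :: "int \<Rightarrow> real^'d^'d"
  assumes S: "Lya S" and D: "\<And>n. invertible (D n)"
    and M: "\<And>n. M n = S (n + 1) ** D n ** matrix_inv (S n)"
  shows "ED_spectrum M = ED_spectrum D"
proof -
  have iS: "\<And>n. invertible (S n)"
    using S by (simp add: Lya_def)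
  have S': "Lya (\<lambda>n. matrix_inv (S n))"
    using S by (simp add: Lya_def invertible_matrix_inv)
  have iM: "invertible (M n)" for n
    unfolding M by (intro invertible_mult iS D invertible_matrix_inv)
  have D': "D n = matrix_inv (S (n + 1)) ** M n ** matrix_inv (matrix_inv (S n))" for n
    by (simp add: M iS invertible_matrix_inv matrix_mul_assoc matrix_inv_right_cancel matrix_inv_left_mult)
  have "has_ED (\<lambda>n. exp (- \<gamma>) *\<^sub>R M n) \<longleftrightarrow> has_ED (\<lambda>n. exp (- \<gamma>) *\<^sub>R D n)" for \<gamma>
  proof
    assume "has_ED (\<lambda>n. exp (- \<gamma>) *\<^sub>R D n)"
    then show "has_ED (\<lambda>n. exp (- \<gamma>) *\<^sub>R M n)"
      by (rule has_ED_similarity[OF S, rotated -1])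
        (auto simp: M D scalar_invertible matrix_scalar_ac scalar_matrix_assoc)
  next
    assume "has_ED (\<lambda>n. exp (- \<gamma>) *\<^sub>R M n)"
    then show "has_ED (\<lambda>n. exp (- \<gamma>) *\<^sub>R D n)"
      by (rule has_ED_similarity[OF S', rotated -1])
        (auto simp: iM D'[of n for n] scalar_invertible matrix_scalar_ac scalar_matrix_assoc)
  qed
  then show ?thesis
    by (simp add: ED_spectrum_def)
qed

text \<open>The \<open>P\<close>-part of \<open>x 0\<close> is transported forward from time
  \<open>- j\<close> and the complementary part backward from time \<open>j\<close>. Both transports
  contract by \<open>exp (- \<alpha>) ^ j\<close>, and boundedness allows \<open>j\<close> to tend
  to infinity.\<close>

lemma has_ED_bounded_solution_zero:
  fixes M :: "int \<Rightarrow> real^'d^'d"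
  assumes "has_ED M" and sol: "\<And>m n. x m = evol M m n *v x n" and x: "\<And>n. norm (x n) \<le> C"
  shows "x 0 = 0"
proof -
  obtain K \<alpha> P where K: "K > 0" "\<alpha> > 0" and
    P: "\<And>m n. P m ** evol M m n = evol M m n ** P n"
    "\<And>m n. n \<le> m \<Longrightarrow> mnorm (evol M m n ** P n) \<le> K * exp (- \<alpha> * real_of_int (m - n))"
    "\<And>m n. m \<le> n \<Longrightarrow> mnorm (evol M m n ** (mat 1 - P n)) \<le> K * exp (\<alpha> * real_of_int (m - n))"
    using \<open>has_ED M\<close> unfolding has_ED_def by metis
  have C: "0 \<le> C"
    using x[of 0] norm_ge_zero[of "x 0"] by linarith
  have bound: "norm (X *v x n) \<le> b * C" if "mnorm X \<le> b" for X :: "real^'d^'d" and b n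
    using norm_le_mnorm[of X "x n"] mult_mono[OF that x[of n]] that mnorm_nonneg[of X] by fastforce
  have "norm (x 0) \<le> 2 * K * C * exp (- \<alpha>) ^ j" for j :: nat
  proof -
    have e: "exp (- \<alpha> * real j) = exp (- \<alpha>) ^ j"
      by (simp add: exp_of_nat_mult[symmetric] mult.commute)
    have "P 0 *v x 0 = (evol M 0 (- int j) ** P (- int j)) *v x (- int j)"
      using P(1)[of 0 "- int j"] sol[of 0 "- int j"] by (metis matrix_vector_mul_assoc)
    then have 1: "norm (P 0 *v x 0) \<le> K * exp (- \<alpha>) ^ j * C"
      using bound[OF P(2)[of "- int j" 0]] e by simp
    have "(mat 1 - P 0) ** evol M 0 (int j) = evol M 0 (int j) ** (mat 1 - P (int j))"
      using P(1)[of 0 "int j"] by (simp add: matrix_mult_diff_left matrix_mult_diff_right)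
    then have "(mat 1 - P 0) *v x 0 = (evol M 0 (int j) ** (mat 1 - P (int j))) *v x (int j)"
      using sol[of 0 "int j"] by (metis matrix_vector_mul_assoc)
    then have 2: "norm ((mat 1 - P 0) *v x 0) \<le> K * exp (- \<alpha>) ^ j * C"
      using bound[OF P(3)[of 0 "int j"]] e by simp
    have "x 0 = P 0 *v x 0 + (mat 1 - P 0) *v x 0"
      by (simp add: matrix_vector_mult_diff_rdistrib)
    then have "norm (x 0) \<le> norm (P 0 *v x 0) + norm ((mat 1 - P 0) *v x 0)"
      by (metis norm_triangle_ineq)
    with 1 2 show ?thesis by (simp add: mult_ac)
  qed
  moreover have "(\<lambda>j. 2 * K * C * exp (- \<alpha>) ^ j) \<longlonglongrightarrow> 2 * K * C * 0"
    using K by (intro tendsto_intros LIMSEQ_realpow_zero) auto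
  ultimately have "norm (x 0) \<le> 2 * K * C * 0"
    by (intro LIMSEQ_le_const) auto
  then show ?thesis by simp
qed

section \<open>Diagonal systems\<close>

definition diag_matrix :: "('n \<Rightarrow> real) \<Rightarrow> real^'n^'n" where
  "diag_matrix f = (\<chi> i j. if i = j then f i else 0)"

lemma diag_matrix_mult: "diag_matrix f ** diag_matrix g = diag_matrix (\<lambda>i. f i * g i)"
  by (simp add: diag_matrix_def matrix_matrix_mult_def vec_eq_iff mult_delta_left mult_delta_right)

lemma diag_matrix_mult_vec: "(diag_matrix f *v x) $ i = f i * x $ i"
  by (simp add: diag_matrix_def matrix_vector_mult_def mult_delta_left)

lemma diag_matrix_one: "diag_matrix (\<lambda>_. 1) = mat 1"
  by (simp add: diag_matrix_def mat_def)

lemma diag_matrix_diff: "diag_matrix f - diag_matrix g = diag_matrix (\<lambda>i. f i - g i)"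
  by (simp add: diag_matrix_def vec_eq_iff)

lemma diag_matrix_scaleR: "k *\<^sub>R diag_matrix f = diag_matrix (\<lambda>i. k * f i)"
  by (simp add: diag_matrix_def vec_eq_iff)

lemma mnorm_diag_matrix:
  assumes "\<And>i. \<bar>f i\<bar> \<le> c"
  shows "mnorm (diag_matrix f) \<le> c"
  unfolding mnorm_def
proof (rule onorm_le)
  fix x
  have "0 \<le> c"
    using assms abs_ge_zero order_trans by blast
  have "norm (diag_matrix f *v x) \<le> norm (c *\<^sub>R x)"
    by (rule norm_le_componentwise_cart)
      (use \<open>0 \<le> c\<close> assms in \<open>simp add: diag_matrix_mult_vec abs_mult mult_right_mono\<close>)
  then show "norm (diag_matrix f *v x) \<le> c * norm x"
    using \<open>0 \<le> c\<close> by simp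
qed

lemma diag_matrix_inverse:
  assumes "\<And>i. f i \<noteq> 0"
  shows "invertible (diag_matrix f)" "matrix_inv (diag_matrix f) = diag_matrix (\<lambda>i. inverse (f i))"
  using matrix_inv_unique[of "diag_matrix f" "diag_matrix (\<lambda>i. inverse (f i))"] assms
  by (simp_all add: diag_matrix_mult diag_matrix_one)

text \<open>Writing the entries as exponentials of increments of a potential \<open>g\<close> makes
  products telescope in both time directions.\<close>

lemma evol_diag_matrix:
  fixes g :: "int \<Rightarrow> 'd::finite \<Rightarrow> real"
  shows "evol (\<lambda>n. diag_matrix (\<lambda>i. exp (g (n + 1) i - g n i))) m n = diag_matrix (\<lambda>i. exp (g m i - g n i))"
proof -
  let ?D = "\<lambda>n. diag_matrix (\<lambda>i. exp (g (n + 1) i - g n i))"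
  have "evol_fwd ?D n j = diag_matrix (\<lambda>i. exp (g (n + int j) i - g n i))" for j
    by (induction j) (simp_all add: diag_matrix_one diag_matrix_mult exp_add[symmetric] add_ac)
  moreover have "evol_bwd ?D n j = diag_matrix (\<lambda>i. exp (g (n - int j) i - g n i))" for j
    by (induction j)
      (simp_all add: diag_matrix_one diag_matrix_mult diag_matrix_inverse exp_minus[symmetric]
        exp_add[symmetric] algebra_simps)
  ultimately show ?thesis
    by (auto simp: evol_def)
qed

text \<open>The coordinate solution \<open>exp (g n i)\<close> is bounded on all of the integers and
  never zero.\<close>

lemma no_ED_diag_matrix:
  fixes g :: "int \<Rightarrow> 'd::finite \<Rightarrow> real"
  assumes "\<And>n. g n i \<le> C"
  shows "\<not> has_ED (\<lambda>n. diag_matrix (\<lambda>i. exp (g (n + 1) i - g n i)))"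
proof
  assume ED: "has_ED (\<lambda>n. diag_matrix (\<lambda>i. exp (g (n + 1) i - g n i)))"
  define x :: "int \<Rightarrow> real^'d" where "x n = exp (g n i) *\<^sub>R axis i 1" for n
  have "x 0 = 0"
  proof (rule has_ED_bounded_solution_zero[OF ED])
    show "x m = evol (\<lambda>n. diag_matrix (\<lambda>i. exp (g (n + 1) i - g n i))) m n *v x n" for m n
      by (simp add: evol_diag_matrix vec_eq_iff diag_matrix_mult_vec x_def axis_def exp_add[symmetric])
    show "norm (x n) \<le> exp C" for n
      using assms by (simp add: x_def)
  qed
  then show False
    by (simp add: x_def)
qed

text \<open>The constant coordinate projection onto \<open>I\<close> commutes with every diagonal
  matrix, so the constant 1 suffices.\<close>

lemma has_ED_diag_matrix:
  fixes g :: "int \<Rightarrow> 'd::finite \<Rightarrow> real"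
  assumes \<alpha>: "0 < \<alpha>"
    and stable: "\<And>i m n. i \<in> I \<Longrightarrow> n \<le> m \<Longrightarrow> g m i - g n i \<le> - \<alpha> * real_of_int (m - n)"
    and unstable: "\<And>i m n. i \<notin> I \<Longrightarrow> m \<le> n \<Longrightarrow> g m i - g n i \<le> \<alpha> * real_of_int (m - n)"
  shows "has_ED (\<lambda>n. diag_matrix (\<lambda>i. exp (g (n + 1) i - g n i)))"
  unfolding has_ED_def evol_diag_matrix
proof (rule exI[of _ 1], rule exI[of _ \<alpha>], rule exI[of _ "\<lambda>_. diag_matrix (indicator I)"],
    intro conjI allI impI)
  show "mnorm (diag_matrix (\<lambda>i. exp (g m i - g n i)) ** diag_matrix (indicator I))
      \<le> 1 * exp (- \<alpha> * real_of_int (m - n))" if "n \<le> m" for m n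
    unfolding diag_matrix_mult
    by (rule mnorm_diag_matrix) (use stable[OF _ that] in \<open>auto simp: indicator_def\<close>)
  show "mnorm (diag_matrix (\<lambda>i. exp (g m i - g n i)) ** (mat 1 - diag_matrix (indicator I)))
      \<le> 1 * exp (\<alpha> * real_of_int (m - n))" if "m \<le> n" for m n
    unfolding diag_matrix_mult diag_matrix_diff diag_matrix_one[symmetric]
    by (rule mnorm_diag_matrix) (use unstable[OF _ that] in \<open>auto simp: indicator_def\<close>)
  show "diag_matrix (indicator I) ** diag_matrix (indicator I) = (diag_matrix (indicator I) :: real^'d^'d)"
    unfolding diag_matrix_mult by (rule arg_cong[where f = diag_matrix]) (auto simp: indicator_def)
  show "diag_matrix (indicator I) ** diag_matrix (\<lambda>i. exp (g m i - g n i))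
      = diag_matrix (\<lambda>i. exp (g m i - g n i)) ** diag_matrix (indicator I)" for m n
    unfolding diag_matrix_mult by (simp only: mult.commute)
qed (use \<alpha> in simp_all)

text \<open>
  The slope \<open>q\<close> is used on the negative and the smaller slope \<open>p\<close> on the positive half-line, so
  that for \<open>\<gamma>\<close> between them the rescaled scalar solution is bounded on both sides.
\<close>

definition two_slopes :: "real \<Rightarrow> real \<Rightarrow> int \<Rightarrow> real" where
  "two_slopes p q n = (if 0 \<le> n then p else q) * real_of_int n"

lemma two_slopes_step: "two_slopes p q (n + 1) - two_slopes p q n = (if 0 \<le> n then p else q)"
proof (cases "n = - 1")
  case False
  then show ?thesis by (auto simp: two_slopes_def algebra_simps)
qed (simp add: two_slopes_def)

lemma two_slopes_diff:
  assumes "p \<le> q" "n \<le> m"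
  shows "p * real_of_int (m - n) \<le> two_slopes p q m - two_slopes p q n"
    "two_slopes p q m - two_slopes p q n \<le> q * real_of_int (m - n)"
proof -
  \<comment> \<open>For \<open>m\<close> and \<open>n\<close> on the same side of 0 a single slope
    acts, and \<open>m - n\<close> decides; for \<open>n < 0 \<le> m\<close> the contributions of
    \<open>m\<close> and \<open>n\<close> are compared separately.\<close>
  have 1: "p * real_of_int k \<le> q * real_of_int k" if "0 \<le> k" for k
    using assms that by (simp add: mult_right_mono)
  have 2: "q * real_of_int k \<le> p * real_of_int k" if "k < 0" for k
    using assms that by (simp add: mult_right_mono_neg)
  show "p * real_of_int (m - n) \<le> two_slopes p q m - two_slopes p q n"
    "two_slopes p q m - two_slopes p q n \<le> q * real_of_int (m - n)"
    using assms(2) 1[of "m - n"] 1[of m] 2[of n]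
    by (auto simp: two_slopes_def algebra_simps)
qed

lemma ED_spectrum_two_slopes:
  fixes p q :: "'d::finite \<Rightarrow> real"
  assumes pq: "\<And>i. p i \<le> q i"
  shows "ED_spectrum (\<lambda>n. diag_matrix (\<lambda>i. exp (if 0 \<le> n then p i else q i))) = (\<Union>i. {p i..q i})"
proof -
  \<comment> \<open>Subtracting \<open>\<gamma> * n\<close> from the potential absorbs the factor
    \<open>exp (- \<gamma>)\<close>.\<close>
  define g where "g \<gamma> n i = two_slopes (p i) (q i) n - \<gamma> * real_of_int n" for \<gamma> n i
  have g: "exp (- \<gamma>) *\<^sub>R diag_matrix (\<lambda>i. exp (if 0 \<le> n then p i else q i))
      = diag_matrix (\<lambda>i. exp (g \<gamma> (n + 1) i - g \<gamma> n i))" for \<gamma> n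
    unfolding diag_matrix_scaleR exp_add[symmetric] two_slopes_step[symmetric]
    by (simp add: g_def algebra_simps)
  have "has_ED (\<lambda>n. diag_matrix (\<lambda>i. exp (g \<gamma> (n + 1) i - g \<gamma> n i))) \<longleftrightarrow> \<gamma> \<notin> (\<Union>i. {p i..q i})" for \<gamma>
  proof
    assume "has_ED (\<lambda>n. diag_matrix (\<lambda>i. exp (g \<gamma> (n + 1) i - g \<gamma> n i)))"
    moreover have "g \<gamma> n i \<le> 0" if "\<gamma> \<in> {p i..q i}" for i n
      using that by (auto simp: g_def two_slopes_def mult_right_mono mult_right_mono_neg)
    ultimately show "\<gamma> \<notin> (\<Union>i. {p i..q i})"
      using no_ED_diag_matrix[of "g \<gamma>"] by blast
  next
    assume \<gamma>: "\<gamma> \<notin> (\<Union>i. {p i..q i})"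
    \<comment> \<open>Off the intervals, each coordinate either decays
      (\<open>q i < \<gamma>\<close>) or grows (\<open>\<gamma> < p i\<close>); \<open>gap i\<close>
      is its rate. The minimum over the finitely many coordinates is a common rate.\<close>
    define gap where "gap i = (if q i < \<gamma> then \<gamma> - q i else p i - \<gamma>)" for i
    have pos: "0 < gap i" for i
      using \<gamma> by (auto simp: gap_def not_le)
    define \<alpha> where "\<alpha> = Min (range gap)"
    show "has_ED (\<lambda>n. diag_matrix (\<lambda>i. exp (g \<gamma> (n + 1) i - g \<gamma> n i)))"
    proof (rule has_ED_diag_matrix[where \<alpha> = \<alpha> and I = "{i. q i < \<gamma>}"])
      show "0 < \<alpha>"
        unfolding \<alpha>_def using pos by (subst Min_gr_iff) auto
      have \<alpha>: "\<alpha> \<le> gap i" for i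
        unfolding \<alpha>_def by (rule Min_le) auto
      fix i and m n :: int
      show "g \<gamma> m i - g \<gamma> n i \<le> - \<alpha> * real_of_int (m - n)" if "i \<in> {i. q i < \<gamma>}" "n \<le> m"
      proof -
        have "\<alpha> * real_of_int (m - n) \<le> (\<gamma> - q i) * real_of_int (m - n)"
          using \<alpha>[of i] that unfolding gap_def by (intro mult_right_mono) auto
        then show ?thesis
          using two_slopes_diff(2)[OF pq that(2), of i] by (simp add: g_def algebra_simps)
      qed
      show "g \<gamma> m i - g \<gamma> n i \<le> \<alpha> * real_of_int (m - n)" if "i \<notin> {i. q i < \<gamma>}" "m \<le> n"
      proof -
        have "\<alpha> * real_of_int (n - m) \<le> (p i - \<gamma>) * real_of_int (n - m)"
          using \<alpha>[of i] that unfolding gap_def by (intro mult_right_mono) auto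
        then show ?thesis
          using two_slopes_diff(1)[OF pq that(2), of i] by (simp add: g_def algebra_simps)
      qed
    qed
  qed
  then show ?thesis
    by (auto simp: ED_spectrum_def g)
qed

lemma Lya_two_slopes:
  fixes p q :: "'d::finite \<Rightarrow> real"
  shows "Lya (\<lambda>n. diag_matrix (\<lambda>i. exp (if 0 \<le> n then p i else q i)))"
proof -
  define c where "c = Max (range (\<lambda>i. max \<bar>p i\<bar> \<bar>q i\<bar>))"
  have c: "max \<bar>p i\<bar> \<bar>q i\<bar> \<le> c" for i
    unfolding c_def by (rule Max_ge) auto
  have "\<bar>p i\<bar> \<le> c" "\<bar>q i\<bar> \<le> c" for i
    using c[of i] by auto
  then have "p i \<le> c" "q i \<le> c" "- p i \<le> c" "- q i \<le> c" for i
    by (meson abs_le_D1 abs_le_D2)+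
  then show ?thesis
    unfolding Lya_def Linf_def
    by (auto simp: diag_matrix_inverse exp_minus[symmetric] intro!: exI[of _ "exp c"] mnorm_diag_matrix)
qed

section \<open>Transfer of the diagonal model to the closed loop\<close>

lemma Lya_similarity:
  fixes D S :: "int \<Rightarrow> real^'d^'d"
  assumes "Lya S" "Lya D"
  shows "Lya (\<lambda>n. S (n + 1) ** D n ** matrix_inv (S n))"
proof -
  obtain c where c: "\<And>n. invertible (S n)" "\<And>n. mnorm (S n) \<le> c" "\<And>n. mnorm (matrix_inv (S n)) \<le> c"
    using LyaD[OF assms(1)] by metis
  obtain b where b: "\<And>n. invertible (D n)" "\<And>n. mnorm (D n) \<le> b" "\<And>n. mnorm (matrix_inv (D n)) \<le> b"
    using LyaD[OF assms(2)] by metis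
  have inv: "matrix_inv (S (n + 1) ** D n ** matrix_inv (S n))
      = S n ** (matrix_inv (D n) ** matrix_inv (S (n + 1)))" for n
    by (simp add: matrix_inv_mult invertible_mult invertible_matrix_inv b c)
  show ?thesis
    unfolding Lya_def Linf_def inv
    by (intro conjI allI exI[of _ "c * b * c"] exI[of _ "c * (b * c)"] mnorm_mult_le invertible_mult
        invertible_matrix_inv b c)
qed

theorem theorem2p5:
  fixes A :: "int \<Rightarrow> real^'d^'d" and B :: "int \<Rightarrow> real^'s^'d"
    and l :: nat and a b :: "nat \<Rightarrow> real"
  assumes "Lya A" and "Linf B" and "UCC A B"
    and "1 \<le> l" and "l \<le> CARD('d)"
    and "\<forall>i\<in>{1..l}. a i \<le> b i"
    and "\<forall>i\<in>{1..l}. \<forall>j\<in>{1..l}. i \<noteq> j \<longrightarrow> {a i..b i} \<inter> {a j..b j} = {}"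
  shows "\<exists>U :: int \<Rightarrow> real^'d^'s. Linf U \<and> Lya (\<lambda>n. A n + B n ** U n) \<and>
           ED_spectrum (\<lambda>n. A n + B n ** U n) = (\<Union>i\<in>{1..l}. {a i..b i})"
proof -
  obtain F where "inj_on F {1..l}" "F ` {1..l} \<subseteq> (UNIV :: 'd set)"
    using card_le_inj[of "{1..l}" "UNIV :: 'd set"] assms(5) by auto
  \<comment> \<open>A left inverse of the injection \<open>F\<close>, so that every interval is
    assigned to some coordinate. Spare coordinates repeat interval 1, which exists since
    \<open>1 \<le> l\<close> and leaves the union unchanged.\<close>
  define f where "f i = (if i \<in> F ` {1..l} then inv_into {1..l} F i else 1)" for i
  have f: "range f = {1..l}"
  proof
    show "range f \<subseteq> {1..l}"
      using assms(4) inv_into_into[of _ F "{1..l}"] by (fastforce simp: f_def)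
    show "{1..l} \<subseteq> range f"
    proof
      fix j assume j: "j \<in> {1..l}"
      then have "f (F j) = j"
        using \<open>inj_on F {1..l}\<close> by (simp add: f_def)
      then show "j \<in> range f" by (metis rangeI)
    qed
  qed
  define D :: "int \<Rightarrow> real^'d^'d"
    where "D n = diag_matrix (\<lambda>i. exp (if 0 \<le> n then a (f i) else b (f i)))" for n
  have D: "Lya D"
    unfolding D_def by (rule Lya_two_slopes)
  obtain U S where U: "Linf U" and S: "Lya S"
    and eq: "\<And>n. A n + B n ** U n = S (n + 1) ** D n ** matrix_inv (S n)"
    using global_Lyapunov_reducibility[OF assms(1-3) D] by metis
  have "Lya (\<lambda>n. A n + B n ** U n)"
    unfolding eq by (rule Lya_similarity[OF S D])
  moreover have "ED_spectrum (\<lambda>n. A n + B n ** U n) = ED_spectrum D"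
    using D by (intro ED_spectrum_similarity[OF S _ eq]) (simp add: Lya_def)
  moreover have "\<dots> = (\<Union>i. {a (f i)..b (f i)})"
    unfolding D_def using f assms(6) by (intro ED_spectrum_two_slopes) blast
  moreover have "\<dots> = (\<Union>i\<in>{1..l}. {a i..b i})"
    unfolding f[symmetric] by auto
  ultimately show ?thesis
    using U by auto
qed

end
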